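(* Consider the CODA dynamics, suppose that there is $\epsilon\in(0,\tfrac12)$ such that $p_j(0)\in[\epsilon,1-\epsilon]$ for all $j\in\mathcal{V}$, and let $i\in\mathcal{V}$ with $n_i\ge1$. If the sequence $(n_i^+(k))_{k\ge0}$ (and thus $(n_i^-(k))_{k\ge0}$) is stationary, i.e. eventually constant, then the sequence of opinions $(p_i(k))_{k\ge0}$ converges and has the limit $$p_i^*=\lim_{k\to\infty}p_i(k)=\frac{\lim_{k\to\infty}n_i^+(k)}{n_i}\in\mathcal{S}.$$ Conversely, if the sequence of opinions $(p_i(k))_{k\ge0}$ converges to a value $p_i^*\in(0,1)$, then the sequence $(n_i^+(k))_{k\ge0}$ is stationary and the equality $p_i^*=\frac{\lim_{k\to\infty}n_i^+(k)}{n_i}$ still holds.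
   Context: $\mathcal{V}=\{1,\dots,n\}$ is a finite set of agents and $\mathcal{G}=(\mathcal{V},\mathcal{E})$ is a fixed graph (directed or undirected, without self-loops). $N_i=\{j\in\mathcal{V}:(j,i)\in\mathcal{E}\}$ is the set of agents influencing $i$, and $n_i=|N_i|$. Time is $k\in\mathbb{N}=\{0,1,2,\dots\}$. Each agent has an opinion $p_i(k)$, with initial opinions $p_i(0)\in(0,1)$, $p_i(0)\ne\frac12$, and an action $q_i(k)\in\{0,1\}$ defined by: $q_i(k)=0$ if $p_i(k)<\frac12$; $q_i(k)=0$ if $p_i(k)=\frac12$ and $p_i(k-1)<\frac12$; $q_i(k)=1$ otherwise. The CODA (continuous opinions, discrete actions) dynamics is $$p_i(k+1)=p_i(k)+\frac{p_i(k)(1-p_i(k))}{n_i}\sum_{j\in N_i}(q_j(k)-p_i(k)),\qquad i\in\mathcal{V},\ k\in\mathbb{N},$$ with the convention that $p_i(k+1)=p_i(k)$ if $n_i=0$. $n_i^-(k)$ and $n_i^+(k)$ denote the numbers of $j\in N_i$ with $q_j(k)=0$ and $q_j(k)=1$, respectively. Finally $$\mathcal{S}=\left\{\frac{k}{m}\ \Big|\ k,m\in\mathbb{N},\ m\ge1,\ k\le m\le n-1\right\}\subset\mathbb{Q}.$$ *)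

theory Defs
  imports Complex_Main
begin

(* The agents are the elements of {1..n}.  A family of trajectories is a function p, where p i k
   is the opinion of agent i at time k. *)

(* A directed edge set on {1..n}; an undirected graph is one for which E is symmetric. *)
definition coda_graph :: "nat \<Rightarrow> (nat \<times> nat) set \<Rightarrow> bool" where
  "coda_graph n E \<longleftrightarrow> E \<subseteq> {1..n} \<times> {1..n} \<and> (\<forall>i. (i, i) \<notin> E)"

(* An edge (j, i) means that j influences i. *)
definition influencers :: "nat \<Rightarrow> (nat \<times> nat) set \<Rightarrow> nat \<Rightarrow> nat set" where
  "influencers n E i = {j \<in> {1..n}. (j, i) \<in> E}"

(* The previous value is consulted only for k \<ge> 1; at k = 0 the value 1/2 is
   excluded by the assumption on the initial opinions. *)
definition action :: "(nat \<Rightarrow> real) \<Rightarrow> nat \<Rightarrow> nat" where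
  "action x k =
     (if x k < 1/2 then 0
      else if x k = 1/2 \<and> k \<ge> 1 \<and> x (k - 1) < 1/2 then 0
      else 1)"

definition n_minus :: "nat \<Rightarrow> (nat \<times> nat) set \<Rightarrow> (nat \<Rightarrow> nat \<Rightarrow> real) \<Rightarrow> nat \<Rightarrow> nat \<Rightarrow> nat" where
  "n_minus n E p i k = card {j \<in> influencers n E i. action (p j) k = 0}"

definition n_plus :: "nat \<Rightarrow> (nat \<times> nat) set \<Rightarrow> (nat \<Rightarrow> nat \<Rightarrow> real) \<Rightarrow> nat \<Rightarrow> nat \<Rightarrow> nat" where
  "n_plus n E p i k = card {j \<in> influencers n E i. action (p j) k = 1}"

definition coda_dynamics :: "nat \<Rightarrow> (nat \<times> nat) set \<Rightarrow> (nat \<Rightarrow> nat \<Rightarrow> real) \<Rightarrow> bool" where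
  "coda_dynamics n E p \<longleftrightarrow>
     (\<forall>i\<in>{1..n}. 0 < p i 0 \<and> p i 0 < 1 \<and> p i 0 \<noteq> 1/2) \<and>
     (\<forall>i\<in>{1..n}. \<forall>k.
        p i (Suc k) =
          (if card (influencers n E i) = 0 then p i k
           else p i k + p i k * (1 - p i k) / real (card (influencers n E i))
                  * (\<Sum>j\<in>influencers n E i. real (action (p j) k) - p i k)))"

definition S_set :: "nat \<Rightarrow> real set" where
  "S_set n = {real k / real m | k m :: nat. m \<ge> 1 \<and> k \<le> m \<and> m \<le> n - 1}"

definition stationary :: "(nat \<Rightarrow> 'a) \<Rightarrow> bool" where
  "stationary x \<longleftrightarrow> (\<exists>c. \<forall>\<^sub>F k in sequentially. x k = c)"

end

theory Submission
  imports Defs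
begin

text \<open>
  Write \<open>m = n\<^sub>i\<close> and \<open>a k = n\<^sub>i\<^sup>+(k) / m\<close>.  The dynamics of agent \<open>i\<close> reads
  \<open>x (k + 1) = x k + x k (1 - x k) (a k - x k)\<close>, which moves \<open>x k\<close> inside \<open>(0,1)\<close> towards \<open>a k\<close>
  without overshooting.  If \<open>a\<close> is eventually a constant \<open>c\<close>, then \<open>x\<close> is eventually monotone and
  its limit is a zero of \<open>y (1 - y) (c - y)\<close>; monotonicity rules out the zeros 0 and 1 unless they
  equal \<open>c\<close>.  Conversely, if \<open>x\<close> has a limit in \<open>(0,1)\<close>, solving the recursion for \<open>a k\<close> shows that
  \<open>a\<close> has the same limit, and the integer sequence \<open>m a k\<close> converges only if it is stationary.
\<close>

lemma coda_step_in_unit_interval: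
  fixes x a :: real
  assumes "0 < x" "x < 1" "0 \<le> a" "a \<le> 1"
  shows "0 < x + x * (1 - x) * (a - x)" "x + x * (1 - x) * (a - x) < 1"
proof -
  have *: "0 < y + y * (1 - y) * (b - y)" if "0 < y" "y < 1" "0 \<le> b" for y b :: real
  proof -
    \<comment> \<open>This regrouping splits the value into a positive and a nonnegative
      term.\<close>
    have "y + y * (1 - y) * (b - y) = y * (1 - y * (1 - y)) + y * (1 - y) * b"
      by (simp add: algebra_simps)
    moreover have "y * (1 - y) < 1"
      using that by (smt (verit) mult_le_one mult_less_cancel_left1)
    ultimately show ?thesis
      using that by (simp add: add_pos_nonneg)
  qed
  show "0 < x + x * (1 - x) * (a - x)"
    using * assms by blast
  show "x + x * (1 - x) * (a - x) < 1"
    \<comment> \<open>Replacing \<open>x\<close> and \<open>a\<close> by \<open>1 - x\<close> and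
      \<open>1 - a\<close> reflects the step at 1/2, so the upper bound is the lower one
      reflected.\<close>
    using *[of "1 - x" "1 - a"] assms by (simp add: algebra_simps)
qed

lemma coda_recursion_tendsto_from_below:
  fixes y :: "nat \<Rightarrow> real"
  assumes rec: "\<And>k. y (Suc k) = y k + y k * (1 - y k) * (c - y k)"
    and y0: "0 < y 0" "y 0 \<le> c" and c: "c \<le> 1"
  shows "y \<longlonglongrightarrow> c"
proof -
  have bounds: "0 < y k \<and> y k \<le> c" for k
  proof (induction k)
    case 0
    then show ?case using y0 by simp
  next
    case (Suc k)
    \<comment> \<open>A factor in [0,1] lets the step cover at most the whole gap
      \<open>c - y k\<close>, hence no overshooting.\<close>
    have t: "0 \<le> y k * (1 - y k)" "y k * (1 - y k) \<le> 1"
      using Suc c by (auto intro!: mult_le_one)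
    have "y k * (1 - y k) * (c - y k) \<le> c - y k"
      using t Suc by (intro mult_left_le_one_le) auto
    moreover have "0 \<le> y k * (1 - y k) * (c - y k)"
      using Suc t by simp
    ultimately show ?case
      using Suc unfolding rec by simp
  qed
  have mono: "incseq y"
  proof (rule incseq_SucI)
    fix k
    have "0 \<le> y k * (1 - y k) * (c - y k)"
      using bounds[of k] c by simp
    then show "y k \<le> y (Suc k)"
      using rec[of k] by linarith
  qed
  obtain L where L: "y \<longlonglongrightarrow> L" "\<And>k. y k \<le> L"
    using incseq_convergent[OF mono, of c] bounds by blast
  have "(\<lambda>k. y (Suc k)) \<longlonglongrightarrow> L + L * (1 - L) * (c - L)"
    unfolding rec by (intro tendsto_intros L)
  then have "L = L + L * (1 - L) * (c - L)"
    using LIMSEQ_unique[OF LIMSEQ_Suc[OF L(1)]] by blast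
  then have "L * (1 - L) * (c - L) = 0"
    by linarith
  moreover have "0 < L"
    using L(2)[of 0] y0 by linarith
  moreover have "L \<le> c"
    using L(1) bounds by (meson LIMSEQ_le_const2)
  \<comment> \<open>The root 0 is excluded by positivity; the root 1 forces \<open>c = 1\<close>,
    because L \<le> c \<le> 1.\<close>
  ultimately have "L = c"
    using c by auto
  then show ?thesis using L by simp
qed

lemma coda_recursion_tendsto:
  fixes y :: "nat \<Rightarrow> real"
  assumes rec: "\<And>k. y (Suc k) = y k + y k * (1 - y k) * (c - y k)"
    and y0: "0 < y 0" "y 0 < 1" and c: "0 \<le> c" "c \<le> 1"
  shows "y \<longlonglongrightarrow> c"
proof (cases "y 0 \<le> c")
  case True
  then show ?thesis
    using coda_recursion_tendsto_from_below[of y c] assms by blast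
next
  case False
  \<comment> \<open>The recursion is invariant under the reflection at \<open>1/2\<close>.\<close>
  have "(\<lambda>k. 1 - y k) \<longlonglongrightarrow> 1 - c"
    by (rule coda_recursion_tendsto_from_below)
      (use False y0 c in \<open>auto simp: rec algebra_simps\<close>)
  from tendsto_diff[OF tendsto_const[of 1] this] show ?thesis
    by simp
qed

text \<open>Far enough out, all terms lie within 1/2 of \<open>L\<close>, so any two differ by less
  than 1 and, being integers, coincide.\<close>

lemma stationary_if_real_tendsto:
  fixes f :: "nat \<Rightarrow> nat"
  assumes "(\<lambda>k. real (f k)) \<longlonglongrightarrow> L"
  shows "stationary f"
proof -
  have "\<forall>\<^sub>F k in sequentially. dist (real (f k)) L < 1/2"
    using assms by (rule tendstoD) simp
  then obtain K where K: "\<And>k. k \<ge> K \<Longrightarrow> dist (real (f k)) L < 1/2"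
    by (auto simp: eventually_sequentially)
  have "f k = f K" if "k \<ge> K" for k
  proof -
    have "dist (real (f k)) (real (f K)) < 1"
      using K[OF that] K[of K] by (metis dist_triangle_half_l dist_commute order_refl)
    then show ?thesis by (simp add: dist_real_def)
  qed
  then show ?thesis
    unfolding stationary_def eventually_sequentially by blast
qed

lemma finite_influencers [simp]: "finite (influencers n E i)"
  by (simp add: influencers_def)

lemma action_cases: "action x k = 0 \<or> action x k = 1"
  by (simp add: action_def)

lemma sum_action_eq_n_plus:
  "(\<Sum>j\<in>influencers n E i. real (action (p j) k)) = real (n_plus n E p i k)"
proof -
  have "real (action (p j) k) = (if action (p j) k = 1 then 1 else 0)" for j
    using action_cases[of "p j" k] by auto
  then show ?thesis
    by (simp add: n_plus_def sum.If_cases Int_def)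
qed

lemma n_plus_le: "n_plus n E p i k \<le> card (influencers n E i)"
  unfolding n_plus_def by (rule card_mono) auto

lemma n_minus_eq: "n_minus n E p i k = card (influencers n E i) - n_plus n E p i k"
proof -
  have "{j \<in> influencers n E i. action (p j) k = 0} =
      influencers n E i - {j \<in> influencers n E i. action (p j) k = 1}"
    using action_cases by fastforce
  then show ?thesis
    by (simp add: n_minus_def n_plus_def card_Diff_subset)
qed

text \<open>The absence of self-loops excludes \<open>i\<close> itself. This bound makes the degree
  an admissible denominator in \<open>S_set n\<close>.\<close>

lemma card_influencers_le:
  assumes "coda_graph n E" "i \<in> {1..n}"
  shows "card (influencers n E i) \<le> n - 1"
proof -
  have "influencers n E i \<subseteq> {1..n} - {i}"
    using assms by (auto simp: influencers_def coda_graph_def)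
  then have "card (influencers n E i) \<le> card ({1..n} - {i})"
    by (intro card_mono) auto
  then show ?thesis using assms by simp
qed

text \<open>Since actions are 0 or 1, the neighbours enter only through the fraction of them with
  action 1; this reduces the dynamics of one agent to a scalar recursion.\<close>

lemma coda_dynamics_step:
  assumes "coda_dynamics n E p" "i \<in> {1..n}" "card (influencers n E i) \<ge> 1"
  shows "p i (Suc k) = p i k + p i k * (1 - p i k)
           * (real (n_plus n E p i k) / real (card (influencers n E i)) - p i k)"
proof -
  let ?m = "real (card (influencers n E i))"
  have sum: "(\<Sum>j\<in>influencers n E i. real (action (p j) k) - p i k) =
      real (n_plus n E p i k) - ?m * p i k"
    by (simp add: sum_subtractf sum_action_eq_n_plus)
  have m: "?m \<noteq> 0"
    using assms(3) by linarith
  have "p i (Suc k) = p i k + p i k * (1 - p i k) / ?m * (real (n_plus n E p i k) - ?m * p i k)"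
    using assms unfolding coda_dynamics_def sum[symmetric] by auto
  also have "\<dots> = p i k + p i k * (1 - p i k) * (real (n_plus n E p i k) / ?m - p i k)"
    using m by (simp add: right_diff_distrib)
  finally show ?thesis .
qed

lemma coda_opinion_in_unit_interval:
  assumes dyn: "coda_dynamics n E p" and i: "i \<in> {1..n}"
    and deg: "card (influencers n E i) \<ge> 1"
  shows "0 < p i k \<and> p i k < 1"
proof (induction k)
  case 0
  then show ?case using dyn i by (simp add: coda_dynamics_def)
next
  case (Suc k)
  have "real (n_plus n E p i k) / real (card (influencers n E i)) \<le> 1"
    using n_plus_le[of n E p i k] deg by simp
  then show ?case
    unfolding coda_dynamics_step[OF assms]
    using Suc by (auto intro!: coda_step_in_unit_interval)
qed

lemma coda_tendsto_if_n_plus_eventually_const: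
  assumes dyn: "coda_dynamics n E p" and i: "i \<in> {1..n}"
    and deg: "card (influencers n E i) \<ge> 1"
    and const: "\<forall>\<^sub>F k in sequentially. n_plus n E p i k = c"
  shows "p i \<longlonglongrightarrow> real c / real (card (influencers n E i))"
proof -
  obtain K where K: "\<And>k. k \<ge> K \<Longrightarrow> n_plus n E p i k = c"
    using const by (auto simp: eventually_sequentially)
  have "c \<le> card (influencers n E i)"
    using K[of K] n_plus_le[of n E p i K] by simp
  then have "real c / real (card (influencers n E i)) \<le> 1"
    using deg by simp
  \<comment> \<open>After the shift by \<open>K\<close> the target is constant from the start, and
    the new initial value \<open>p i K\<close> still lies in (0,1).\<close>
  then have "(\<lambda>k. p i (k + K)) \<longlonglongrightarrow> real c / real (card (influencers n E i))"
    using coda_opinion_in_unit_interval[OF dyn i deg] coda_dynamics_step[OF dyn i deg] K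
    by (intro coda_recursion_tendsto) auto
  then show ?thesis by (rule LIMSEQ_offset)
qed

lemma coda_n_plus_tendsto:
  assumes dyn: "coda_dynamics n E p" and i: "i \<in> {1..n}"
    and deg: "card (influencers n E i) \<ge> 1"
    and lim: "p i \<longlonglongrightarrow> L" and L: "0 < L" "L < 1"
  shows "(\<lambda>k. real (n_plus n E p i k)) \<longlonglongrightarrow> real (card (influencers n E i)) * L"
proof -
  let ?m = "real (card (influencers n E i))"
  have m: "?m \<noteq> 0"
    using deg by linarith
  \<comment> \<open>The recursion solved for \<open>n_plus\<close>; the divisor is nonzero because
    opinions stay strictly inside (0,1).\<close>
  have eq: "real (n_plus n E p i k) =
      ?m * (p i k + (p i (Suc k) - p i k) / (p i k * (1 - p i k)))" for k
    using coda_opinion_in_unit_interval[OF dyn i deg, of k] m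
    unfolding coda_dynamics_step[OF dyn i deg] by simp
  \<comment> \<open>The increments tend to 0, while the denominators tend to
    \<open>L * (1 - L)\<close>, which is nonzero as \<open>L\<close> is neither 0 nor 1.\<close>
  have "(\<lambda>k. ?m * (p i k + (p i (Suc k) - p i k) / (p i k * (1 - p i k))))
      \<longlonglongrightarrow> ?m * (L + (L - L) / (L * (1 - L)))"
    by (intro tendsto_intros lim LIMSEQ_Suc) (use L in auto)
  then show ?thesis
    unfolding eq by simp
qed

theorem proposition4:
  fixes n :: nat and E :: "(nat \<times> nat) set" and p :: "nat \<Rightarrow> nat \<Rightarrow> real"
    and \<epsilon> :: real and i :: nat
  assumes graph: "coda_graph n E"
    and dyn: "coda_dynamics n E p"
    and eps: "0 < \<epsilon>" "\<epsilon> < 1/2"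
    and init: "\<forall>j\<in>{1..n}. p j 0 \<in> {\<epsilon>..1 - \<epsilon>}"
    and i: "i \<in> {1..n}"
    and deg: "card (influencers n E i) \<ge> 1"
  shows "(stationary (n_plus n E p i) \<longrightarrow>
            stationary (n_minus n E p i) \<and>
            convergent (p i) \<and>
            lim (p i) = lim (\<lambda>k. real (n_plus n E p i k)) / real (card (influencers n E i)) \<and>
            lim (p i) \<in> S_set n) \<and>
         (\<forall>pstar. 0 < pstar \<and> pstar < 1 \<and> p i \<longlonglongrightarrow> pstar \<longrightarrow>
            stationary (n_plus n E p i) \<and>
            pstar = lim (\<lambda>k. real (n_plus n E p i k)) / real (card (influencers n E i)))"
proof -
  let ?m = "card (influencers n E i)"
  have "stationary (n_minus n E p i) \<and> convergent (p i) \<and>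
      lim (p i) = lim (\<lambda>k. real (n_plus n E p i k)) / real ?m \<and> lim (p i) \<in> S_set n"
    if stat: "stationary (n_plus n E p i)"
  proof -
    obtain c where c: "\<forall>\<^sub>F k in sequentially. n_plus n E p i k = c"
      using stat unfolding stationary_def by blast
    have "\<forall>\<^sub>F k in sequentially. n_minus n E p i k = ?m - c"
      using c by eventually_elim (simp add: n_minus_eq)
    then have minus: "stationary (n_minus n E p i)"
      unfolding stationary_def by blast
    have tends: "p i \<longlonglongrightarrow> real c / real ?m"
      by (rule coda_tendsto_if_n_plus_eventually_const[OF dyn i deg c])
    have "(\<lambda>k. real (n_plus n E p i k)) \<longlonglongrightarrow> real c"
      by (rule tendsto_eventually) (use c in eventually_elim, simp)
    then have lim_plus: "lim (\<lambda>k. real (n_plus n E p i k)) = real c"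
      by (rule limI)
    obtain k where "n_plus n E p i k = c"
      using c by (auto simp: eventually_sequentially)
    then have "c \<le> ?m"
      using n_plus_le by metis
    then have "real c / real ?m \<in> S_set n"
      using deg card_influencers_le[OF graph i] unfolding S_set_def by blast
    then show ?thesis
      using minus tends limI[OF tends] lim_plus by (auto simp: convergent_def)
  qed
  moreover have "stationary (n_plus n E p i) \<and>
      pstar = lim (\<lambda>k. real (n_plus n E p i k)) / real ?m"
    if "0 < pstar" "pstar < 1" "p i \<longlonglongrightarrow> pstar" for pstar
  proof -
    have "(\<lambda>k. real (n_plus n E p i k)) \<longlonglongrightarrow> real ?m * pstar"
      by (rule coda_n_plus_tendsto[OF dyn i deg that(3,1,2)])
    \<comment> \<open>Convergence of the integer counts yields stationarity, and their limit
      \<open>?m * pstar\<close> is divided by the nonzero \<open>?m\<close>.\<close>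
    then show ?thesis
      using stationary_if_real_tendsto limI deg by fastforce
  qed
  ultimately show ?thesis by blast
qed

end
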